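(* Let $L$ be a complete commutative residuated lattice, $X,X',A$ $L$-enriched categories, $R\colon X\to A$, $\mu\colon X\to L$, $R'\colon X'\to A$, $\mu'\colon X'\to L$ $L$-enriched functors, and $i\colon X\to X'$ an $L$-enriched functor with $R'\circ i=R$ and $\mu'\circ i=\mu$ (an update from $\langle R,\mu\rangle$ to $\langle R',\mu'\rangle$). Then $\overline{R}\mu\trianglelefteq\overline{R'}\mu'$ and $\underline{R'}\mu'\trianglelefteq\underline{R}\mu$.
   Context: A complete commutative residuated lattice is a complete lattice $(L,\preceq)$ with a commutative monoid $(1,\cdot)$ such that each $p\cdot(-)$ has a right adjoint $p\Rightarrow(-)$: $p\cdot q\preceq r$ iff $q\preceq(p\Rightarrow r)$. An $L$-enriched category $X$ is a set with $X(-,-)\colon X\times X\to L$ satisfying $1\preceq X(x,x)$ and $X(y,z)\cdot X(x,y)\preceq X(x,z)$. An $L$-enriched functor $F\colon X\to Y$ is a function with $X(x,x')\preceq Y(Fx,Fx')$. $L$ is an $L$-enriched category with $L(p,q)=(p\Rightarrow q)$; $L^{X}$ is the set of $L$-enriched functors $X\to L$ with $L^{X}(\mu,\nu)=\bigwedge_x(\mu x\Rightarrow\nu x)$. For $L$-enriched functors $F,G\colon X\to Y$, $F\trianglelefteq G$ means $1\preceq Y(Fx,Gx)$ for all $x\in X$ (for $\mu,\nu\in L^{A}$ this means $\mu a\preceq\nu a$ for all $a$). For an $L$-enriched functor $S\colon X\to A$, $S^{*}\colon L^{A}\to L^{X}$ is $S^{*}\nu=\nu\circ S$; the $L$-enriched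 upper approximation $\overline{S}\colon L^{X}\to L^{A}$ is the left $L$-enriched adjoint of $S^{*}$ and the $L$-enriched lower approximation $\underline{S}$ is the right $L$-enriched adjoint, where $F\colon X\to Y$ is left $L$-enriched adjoint to $G\colon Y\to X$ if $Y(Fx,y)=X(x,Gy)$ for all $x,y$. *)

theory Defs
  imports Main "HOL-Library.FuncSet"
begin

text \<open>The underlying type carries the whole lattice. The unit \<open>1\<close> is not assumed to be \<open>top\<close>.\<close>

class complete_comm_residuated_lattice = complete_lattice + comm_monoid_mult +
  fixes residuum :: "'a \<Rightarrow> 'a \<Rightarrow> 'a"  (infixr "\<rhd>" 60)
  assumes residuation: "p * q \<le> r \<longleftrightarrow> q \<le> (p \<rhd> r)"

text \<open>Enriched categories have an explicit, possibly empty, set of objects; values of \<open>hom\<close> outside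
  it are irrelevant.\<close>

record ('x, 'l) enriched =
  ob :: "'x set"
  hom :: "'x \<Rightarrow> 'x \<Rightarrow> 'l"

definition enriched_category :: "('x, 'l::complete_comm_residuated_lattice) enriched \<Rightarrow> bool" where
  "enriched_category X \<longleftrightarrow>
     (\<forall>x\<in>ob X. 1 \<le> hom X x x) \<and>
     (\<forall>x\<in>ob X. \<forall>y\<in>ob X. \<forall>z\<in>ob X. hom X y z * hom X x y \<le> hom X x z)"

text \<open>Functors are extensional functions, i.e. \<open>undefined\<close> outside the object set of their domain,
  so that two functors are equal iff they agree on objects.\<close>

definition enriched_functors ::
  "('x, 'l::complete_comm_residuated_lattice) enriched \<Rightarrow> ('y, 'l) enriched \<Rightarrow> ('x \<Rightarrow> 'y) set" where
  "enriched_functors X Y =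
     {F \<in> ob X \<rightarrow>\<^sub>E ob Y. \<forall>x\<in>ob X. \<forall>x'\<in>ob X. hom X x x' \<le> hom Y (F x) (F x')}"

definition base_category :: "('l::complete_comm_residuated_lattice, 'l) enriched" where
  "base_category = \<lparr>ob = UNIV, hom = (\<lambda>p q. p \<rhd> q)\<rparr>"

definition copresheaves ::
  "('x, 'l::complete_comm_residuated_lattice) enriched \<Rightarrow> ('x \<Rightarrow> 'l, 'l) enriched" where
  "copresheaves X =
     \<lparr>ob = enriched_functors X base_category, hom = (\<lambda>\<mu> \<nu>. INF x\<in>ob X. \<mu> x \<rhd> \<nu> x)\<rparr>"

definition functor_le ::
  "('x, 'l::complete_comm_residuated_lattice) enriched \<Rightarrow> ('y, 'l) enriched
    \<Rightarrow> ('x \<Rightarrow> 'y) \<Rightarrow> ('x \<Rightarrow> 'y) \<Rightarrow> bool" where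
  "functor_le X Y F G \<longleftrightarrow> (\<forall>x\<in>ob X. 1 \<le> hom Y (F x) (G x))"

definition left_adjoint ::
  "('x, 'l::complete_comm_residuated_lattice) enriched \<Rightarrow> ('y, 'l) enriched
    \<Rightarrow> ('x \<Rightarrow> 'y) \<Rightarrow> ('y \<Rightarrow> 'x) \<Rightarrow> bool" where
  "left_adjoint X Y F G \<longleftrightarrow>
     F \<in> enriched_functors X Y \<and> G \<in> enriched_functors Y X \<and>
     (\<forall>x\<in>ob X. \<forall>y\<in>ob Y. hom Y (F x) y = hom X x (G y))"

definition precomposition ::
  "('x, 'l::complete_comm_residuated_lattice) enriched \<Rightarrow> ('a, 'l) enriched
    \<Rightarrow> ('x \<Rightarrow> 'a) \<Rightarrow> ('a \<Rightarrow> 'l) \<Rightarrow> ('x \<Rightarrow> 'l)" where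
  "precomposition X A S = (\<lambda>\<nu>\<in>ob (copresheaves A). compose (ob X) \<nu> S)"

text \<open>The two adjoints of precomposition with an enriched functor \<open>S\<close> exist and are unique, since
  copresheaf categories are separated and functors are extensional; hence \<open>THE\<close> below.\<close>

definition upper_approx ::
  "('x, 'l::complete_comm_residuated_lattice) enriched \<Rightarrow> ('a, 'l) enriched
    \<Rightarrow> ('x \<Rightarrow> 'a) \<Rightarrow> ('x \<Rightarrow> 'l) \<Rightarrow> ('a \<Rightarrow> 'l)" where
  "upper_approx X A S =
     (THE F. left_adjoint (copresheaves X) (copresheaves A) F (precomposition X A S))"

definition lower_approx ::
  "('x, 'l::complete_comm_residuated_lattice) enriched \<Rightarrow> ('a, 'l) enriched
    \<Rightarrow> ('x \<Rightarrow> 'a) \<Rightarrow> ('x \<Rightarrow> 'l) \<Rightarrow> ('a \<Rightarrow> 'l)" where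
  "lower_approx X A S =
     (THE G. left_adjoint (copresheaves A) (copresheaves X) (precomposition X A S) G)"

end

theory Submission
  imports Defs
begin

text \<open>The adjoints of precomposition with \<open>S\<close> are the Kan extensions
  \<open>a \<mapsto> (SUP x. A(S x, a) \<cdot> \<mu> x)\<close> and \<open>a \<mapsto> (INF x. A(a, S x) \<rhd> \<mu> x)\<close>. Since \<open>R = R' \<circ> i\<close> and
  \<open>\<mu> = \<mu>' \<circ> i\<close>, the supremum (infimum) for \<open>\<langle>R, \<mu>\<rangle>\<close> ranges over a subfamily of the one for
  \<open>\<langle>R', \<mu>'\<rangle>\<close>.\<close>

section \<open>Order and residuation in the base lattice\<close>

lemma order_eq_if_same_lower_bounds:
  fixes a b :: "'a::order"
  assumes "\<And>p. p \<le> a \<longleftrightarrow> p \<le> b"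
  shows "a = b"
  using assms[of a] assms[of b] by simp

lemma residuated_mult_left_mono:
  fixes p q r :: "'l::complete_comm_residuated_lattice"
  assumes "q \<le> r"
  shows "p * q \<le> p * r"
  using assms order.trans residuation by blast

lemma residuated_mult_mono:
  fixes p q r s :: "'l::complete_comm_residuated_lattice"
  assumes "p \<le> q" "r \<le> s"
  shows "p * r \<le> q * s"
  using residuated_mult_left_mono[OF assms(1), of r] residuated_mult_left_mono[OF assms(2), of q]
  by (simp add: mult.commute)

text \<open>Multiplication by \<open>p\<close> is a left adjoint, so it commutes with suprema, empty
  ones included.\<close>

lemma residuated_mult_SUP_le_iff:
  fixes f :: "'i \<Rightarrow> 'l::complete_comm_residuated_lattice"
  shows "p * (SUP i\<in>I. f i) \<le> r \<longleftrightarrow> (\<forall>i\<in>I. p * f i \<le> r)"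
  by (simp add: residuation SUP_le_iff)

lemma one_le_residuum_iff:
  "1 \<le> (p \<rhd> q) \<longleftrightarrow> p \<le> (q::'l::complete_comm_residuated_lattice)"
  using residuation[of p 1 q] by simp

text \<open>Modus ponens twice: evaluation \<open>p * (p \<rhd> q) \<le> q\<close> followed by
  \<open>q * (q \<rhd> r) \<le> r\<close>, then transposition of \<open>p\<close>. This is the
  composition law of the base category.\<close>

lemma residuum_comp:
  fixes p q r :: "'l::complete_comm_residuated_lattice"
  shows "(q \<rhd> r) * (p \<rhd> q) \<le> (p \<rhd> r)"
proof -
  have "p * (p \<rhd> q) \<le> q" and "q * (q \<rhd> r) \<le> r"
    by (simp_all add: residuation)
  then have "(p * (p \<rhd> q)) * (q \<rhd> r) \<le> r"
    by (meson residuated_mult_mono order.refl order.trans)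
  then show ?thesis
    by (simp add: residuation[symmetric] ac_simps)
qed

section \<open>Enriched functors and copresheaf categories\<close>

lemma base_category_simps [simp]:
  "ob base_category = UNIV" "hom base_category p q = (p \<rhd> q)"
  by (simp_all add: base_category_def)

lemma copresheaves_simps [simp]:
  "ob (copresheaves X) = enriched_functors X base_category"
  "hom (copresheaves X) \<mu> \<nu> = (INF x\<in>ob X. \<mu> x \<rhd> \<nu> x)"
  by (simp_all add: copresheaves_def)

text \<open>Residuation turns functoriality into the base into an action law, in which no residuum
  occurs.\<close>

lemma copresheaf_iff:
  "\<mu> \<in> enriched_functors X base_category \<longleftrightarrow>
     \<mu> \<in> extensional (ob X) \<and> (\<forall>x\<in>ob X. \<forall>y\<in>ob X. \<mu> x * hom X x y \<le> \<mu> y)"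
  by (auto simp: enriched_functors_def PiE_def residuation)

lemma enriched_functor_ob:
  "F \<in> enriched_functors X Y \<Longrightarrow> x \<in> ob X \<Longrightarrow> F x \<in> ob Y"
  by (auto simp: enriched_functors_def)

lemma enriched_functor_hom:
  "F \<in> enriched_functors X Y \<Longrightarrow> x \<in> ob X \<Longrightarrow> y \<in> ob X \<Longrightarrow> hom X x y \<le> hom Y (F x) (F y)"
  by (auto simp: enriched_functors_def)

lemma enriched_category_id:
  "enriched_category X \<Longrightarrow> x \<in> ob X \<Longrightarrow> 1 \<le> hom X x x"
  by (simp add: enriched_category_def)

lemma enriched_category_comp:
  "enriched_category X \<Longrightarrow> x \<in> ob X \<Longrightarrow> y \<in> ob X \<Longrightarrow> z \<in> ob X \<Longrightarrow>
     hom X y z * hom X x y \<le> hom X x z"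
  by (simp add: enriched_category_def)

lemma enriched_functor_compose:
  assumes "F \<in> enriched_functors X Y" "G \<in> enriched_functors Y Z"
  shows "compose (ob X) G F \<in> enriched_functors X Z"
proof -
  have "hom X x y \<le> hom Z (G (F x)) (G (F y))" if "x \<in> ob X" "y \<in> ob X" for x y
    using assms that by (meson enriched_functor_hom enriched_functor_ob order.trans)
  then show ?thesis
    using assms by (auto simp: enriched_functors_def compose_def)
qed

lemma enriched_category_copresheaves: "enriched_category (copresheaves X)"
proof -
  have "(INF x\<in>ob X. \<nu> x \<rhd> \<kappa> x) * (INF x\<in>ob X. \<mu> x \<rhd> \<nu> x) \<le> (INF x\<in>ob X. \<mu> x \<rhd> \<kappa> x)"
    for \<mu> \<nu> \<kappa> :: "'a \<Rightarrow> 'b"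
  proof (rule INF_greatest)
    fix x assume "x \<in> ob X"
    then have "(INF x\<in>ob X. \<nu> x \<rhd> \<kappa> x) * (INF x\<in>ob X. \<mu> x \<rhd> \<nu> x) \<le> (\<nu> x \<rhd> \<kappa> x) * (\<mu> x \<rhd> \<nu> x)"
      by (intro residuated_mult_mono INF_lower)
    also have "\<dots> \<le> (\<mu> x \<rhd> \<kappa> x)"
      by (rule residuum_comp)
    finally show "(INF x\<in>ob X. \<nu> x \<rhd> \<kappa> x) * (INF x\<in>ob X. \<mu> x \<rhd> \<nu> x) \<le> (\<mu> x \<rhd> \<kappa> x)" .
  qed
  then show ?thesis
    by (simp add: enriched_category_def le_INF_iff one_le_residuum_iff)
qed

text \<open>Antisymmetry is inherited pointwise from the base, and extensionality settles the values
  off \<open>ob X\<close>. This supplies the separation hypothesis in the uniqueness lemmas for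
  adjoints.\<close>

lemma copresheaves_separated:
  assumes "\<mu> \<in> ob (copresheaves X)" "\<nu> \<in> ob (copresheaves X)"
    and "1 \<le> hom (copresheaves X) \<mu> \<nu>" "1 \<le> hom (copresheaves X) \<nu> \<mu>"
  shows "\<mu> = \<nu>"
proof (rule extensionalityI)
  show "\<mu> \<in> extensional (ob X)" "\<nu> \<in> extensional (ob X)"
    using assms(1,2) by (simp_all add: copresheaf_iff)
  show "\<mu> x = \<nu> x" if "x \<in> ob X" for x
    using assms(3,4) that by (simp add: le_INF_iff one_le_residuum_iff order.antisym)
qed

section \<open>Enriched adjunctions and uniqueness of adjoints\<close>

text \<open>The hom identity alone forces both maps to be enriched functors.\<close>

lemma left_adjointI:
  assumes X: "enriched_category X" and Y: "enriched_category Y"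
    and F: "F \<in> ob X \<rightarrow>\<^sub>E ob Y" and G: "G \<in> ob Y \<rightarrow>\<^sub>E ob X"
    and adj: "\<And>x y. x \<in> ob X \<Longrightarrow> y \<in> ob Y \<Longrightarrow> hom Y (F x) y = hom X x (G y)"
  shows "left_adjoint X Y F G"
proof -
  have "hom X x x' \<le> hom Y (F x) (F x')" if x: "x \<in> ob X" "x' \<in> ob X" for x x'
  proof -
    have ob: "F x' \<in> ob Y" "G (F x') \<in> ob X"
      using F G x by auto
    \<comment> \<open>The unit of the adjunction at \<open>x'\<close>: the hom identity transposes
      the identity of \<open>F x'\<close>. Composing with it and transposing back gives
      functoriality of \<open>F\<close>.\<close>
    have "1 \<le> hom X x' (G (F x'))"
      using enriched_category_id[OF Y ob(1)] adj[OF x(2) ob(1)] by simp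
    then have "1 * hom X x x' \<le> hom X x' (G (F x')) * hom X x x'"
      by (rule residuated_mult_mono) simp
    also have "\<dots> \<le> hom X x (G (F x'))"
      using X x ob by (blast intro: enriched_category_comp)
    finally show ?thesis
      using adj x ob by simp
  qed
  moreover have "hom Y y y' \<le> hom X (G y) (G y')" if y: "y \<in> ob Y" "y' \<in> ob Y" for y y'
  proof -
    have ob: "G y \<in> ob X" "F (G y) \<in> ob Y"
      using F G y by auto
    \<comment> \<open>Dually, the counit at \<open>y\<close> is the transpose of the identity of
      \<open>G y\<close>.\<close>
    have "1 \<le> hom Y (F (G y)) y"
      using enriched_category_id[OF X ob(1)] adj[OF ob(1) y(1)] by simp
    then have "hom Y y y' * 1 \<le> hom Y y y' * hom Y (F (G y)) y"
      by (rule residuated_mult_left_mono)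
    also have "\<dots> \<le> hom Y (F (G y)) y'"
      using Y y ob by (blast intro: enriched_category_comp)
    finally show ?thesis
      using adj y ob by simp
  qed
  ultimately show ?thesis
    using F G adj by (simp add: left_adjoint_def enriched_functors_def)
qed

text \<open>A Yoneda argument: \<open>F x\<close> and \<open>F' x\<close> both represent
  \<open>\<lambda>y. hom X x (G y)\<close>. Taking \<open>y\<close> to be each of them in turn,
  their identities give the two inequalities that separation needs.\<close>

lemma left_adjoint_unique:
  assumes Y: "enriched_category Y"
    and sep: "\<And>y y'. y \<in> ob Y \<Longrightarrow> y' \<in> ob Y \<Longrightarrow> 1 \<le> hom Y y y' \<Longrightarrow> 1 \<le> hom Y y' y \<Longrightarrow> y = y'"
    and F: "left_adjoint X Y F G" and F': "left_adjoint X Y F' G"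
  shows "F = F'"
proof (rule PiE_ext)
  show mem: "F \<in> ob X \<rightarrow>\<^sub>E ob Y" "F' \<in> ob X \<rightarrow>\<^sub>E ob Y"
    using F F' by (simp_all add: left_adjoint_def enriched_functors_def)
  fix x assume x: "x \<in> ob X"
  have ob: "F x \<in> ob Y" "F' x \<in> ob Y"
    using mem x by auto
  have "hom Y (F x) y = hom Y (F' x) y" if "y \<in> ob Y" for y
    using F F' x that by (simp add: left_adjoint_def)
  then show "F x = F' x"
    using sep[OF ob] enriched_category_id[OF Y] ob by metis
qed

lemma right_adjoint_unique:
  assumes X: "enriched_category X"
    and sep: "\<And>x x'. x \<in> ob X \<Longrightarrow> x' \<in> ob X \<Longrightarrow> 1 \<le> hom X x x' \<Longrightarrow> 1 \<le> hom X x' x \<Longrightarrow> x = x'"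
    and G: "left_adjoint X Y F G" and G': "left_adjoint X Y F G'"
  shows "G = G'"
proof (rule PiE_ext)
  show mem: "G \<in> ob Y \<rightarrow>\<^sub>E ob X" "G' \<in> ob Y \<rightarrow>\<^sub>E ob X"
    using G G' by (simp_all add: left_adjoint_def enriched_functors_def)
  fix y assume y: "y \<in> ob Y"
  have ob: "G y \<in> ob X" "G' y \<in> ob X"
    using mem y by auto
  have "hom X x (G y) = hom X x (G' y)" if "x \<in> ob X" for x
    using G G' y that by (simp add: left_adjoint_def)
  then show "G y = G' y"
    using sep[OF ob] enriched_category_id[OF X] ob by metis
qed

section \<open>Kan extensions as adjoints of precomposition\<close>

definition left_kan ::
  "('x, 'l::complete_comm_residuated_lattice) enriched \<Rightarrow> ('a, 'l) enriched
    \<Rightarrow> ('x \<Rightarrow> 'a) \<Rightarrow> ('x \<Rightarrow> 'l) \<Rightarrow> ('a \<Rightarrow> 'l)" where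
  "left_kan X A S = (\<lambda>\<mu>\<in>ob (copresheaves X). \<lambda>a\<in>ob A. SUP x\<in>ob X. hom A (S x) a * \<mu> x)"

definition right_kan ::
  "('x, 'l::complete_comm_residuated_lattice) enriched \<Rightarrow> ('a, 'l) enriched
    \<Rightarrow> ('x \<Rightarrow> 'a) \<Rightarrow> ('x \<Rightarrow> 'l) \<Rightarrow> ('a \<Rightarrow> 'l)" where
  "right_kan X A S = (\<lambda>\<mu>\<in>ob (copresheaves X). \<lambda>a\<in>ob A. INF x\<in>ob X. hom A a (S x) \<rhd> \<mu> x)"

lemma precomposition_PiE:
  assumes "S \<in> enriched_functors X A"
  shows "precomposition X A S \<in> ob (copresheaves A) \<rightarrow>\<^sub>E ob (copresheaves X)"
  using enriched_functor_compose[OF assms] by (auto simp: precomposition_def)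

lemma precomposition_apply:
  assumes "\<nu> \<in> ob (copresheaves A)" "x \<in> ob X"
  shows "precomposition X A S \<nu> x = \<nu> (S x)"
  using assms by (simp add: precomposition_def compose_def)

text \<open>The restricted abstractions in \<open>left_kan\<close> give extensionality of the map
  and of its values. The action law holds because composition in \<open>A\<close> absorbs the factor
  \<open>hom A a b\<close> into each term of the supremum.\<close>

lemma left_kan_PiE:
  assumes A: "enriched_category A" and S: "S \<in> enriched_functors X A"
  shows "left_kan X A S \<in> ob (copresheaves X) \<rightarrow>\<^sub>E ob (copresheaves A)"
proof -
  have "hom A a b * (SUP x\<in>ob X. hom A (S x) a * \<mu> x) \<le> (SUP x\<in>ob X. hom A (S x) b * \<mu> x)"
    if a: "a \<in> ob A" and b: "b \<in> ob A" for \<mu> a b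
  proof (unfold residuated_mult_SUP_le_iff, intro ballI)
    fix x assume x: "x \<in> ob X"
    have "hom A a b * hom A (S x) a \<le> hom A (S x) b"
      using A a b enriched_functor_ob[OF S x] by (blast intro: enriched_category_comp)
    then have "hom A a b * hom A (S x) a * \<mu> x \<le> hom A (S x) b * \<mu> x"
      by (rule residuated_mult_mono) simp
    also have "\<dots> \<le> (SUP x\<in>ob X. hom A (S x) b * \<mu> x)"
      using x by (rule SUP_upper)
    finally show "hom A a b * (hom A (S x) a * \<mu> x) \<le> (SUP x\<in>ob X. hom A (S x) b * \<mu> x)"
      by (simp only: mult.assoc)
  qed
  then show ?thesis
    \<comment> \<open>\<open>copresheaf_iff\<close> has the value, here a supremum, as the left
      factor; the instance of commutativity moves it to the right.\<close>
    by (simp add: left_kan_def copresheaf_iff mult.commute[of "Sup _"])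
qed

text \<open>Each component is checked after transposing \<open>hom A b (S x)\<close>: composition in
  \<open>A\<close> yields \<open>hom A a (S x)\<close>, which the residuum then evaluates.\<close>

lemma right_kan_PiE:
  assumes A: "enriched_category A" and S: "S \<in> enriched_functors X A"
  shows "right_kan X A S \<in> ob (copresheaves X) \<rightarrow>\<^sub>E ob (copresheaves A)"
proof -
  have "(INF x\<in>ob X. hom A a (S x) \<rhd> \<mu> x) * hom A a b \<le> (hom A b (S x) \<rhd> \<mu> x)"
    if "a \<in> ob A" "b \<in> ob A" "x \<in> ob X" for \<mu> a b x
  proof -
    have "hom A b (S x) * hom A a b \<le> hom A a (S x)"
      using A that enriched_functor_ob[OF S] by (blast intro: enriched_category_comp)
    moreover have "(INF x\<in>ob X. hom A a (S x) \<rhd> \<mu> x) \<le> (hom A a (S x) \<rhd> \<mu> x)"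
      using that by (blast intro: INF_lower)
    ultimately have "hom A b (S x) * hom A a b * (INF x\<in>ob X. hom A a (S x) \<rhd> \<mu> x)
        \<le> hom A a (S x) * (hom A a (S x) \<rhd> \<mu> x)"
      by (rule residuated_mult_mono)
    also have "\<dots> \<le> \<mu> x"
      by (simp add: residuation)
    finally show ?thesis
      by (simp add: residuation[symmetric] ac_simps)
  qed
  then show ?thesis
    by (auto simp: right_kan_def copresheaf_iff le_INF_iff)
qed

text \<open>A map out of the extension amounts to its values at the points \<open>S x\<close>:
  identities of \<open>A\<close> restrict the inequalities to these points, and the action law of
  \<open>\<nu>\<close> recovers the rest.\<close>

lemma left_kan_adjoint:
  assumes A: "enriched_category A" and S: "S \<in> enriched_functors X A"
  shows "left_adjoint (copresheaves X) (copresheaves A) (left_kan X A S) (precomposition X A S)"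
proof (rule left_adjointI[OF enriched_category_copresheaves enriched_category_copresheaves
      left_kan_PiE[OF A S] precomposition_PiE[OF S]])
  fix \<mu> \<nu> assume \<mu>: "\<mu> \<in> ob (copresheaves X)" and \<nu>: "\<nu> \<in> ob (copresheaves A)"
  \<comment> \<open>Comparing lower bounds \<open>p\<close> unfolds both homs into families of
    inequalities free of infima, suprema and residua.\<close>
  have "(p \<le> hom (copresheaves A) (left_kan X A S \<mu>) \<nu>) \<longleftrightarrow>
      (p \<le> hom (copresheaves X) \<mu> (precomposition X A S \<nu>))" for p
  proof -
    have "(\<forall>a\<in>ob A. \<forall>x\<in>ob X. p * (hom A (S x) a * \<mu> x) \<le> \<nu> a) \<longleftrightarrow>
        (\<forall>x\<in>ob X. p * \<mu> x \<le> \<nu> (S x))"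
    proof (intro iffI ballI)
      fix x assume *: "\<forall>a\<in>ob A. \<forall>x\<in>ob X. p * (hom A (S x) a * \<mu> x) \<le> \<nu> a" and x: "x \<in> ob X"
      have ob: "S x \<in> ob A"
        using S x by (rule enriched_functor_ob)
      \<comment> \<open>The hypothesis is used at \<open>a = S x\<close>, where the identity of
        \<open>S x\<close> fills the hom factor.\<close>
      have "1 * (p * \<mu> x) \<le> hom A (S x) (S x) * (p * \<mu> x)"
        using enriched_category_id[OF A ob] by (rule residuated_mult_mono) simp
      also have "\<dots> \<le> \<nu> (S x)"
        using * x ob by (simp add: ac_simps)
      finally show "p * \<mu> x \<le> \<nu> (S x)"
        by simp
    next
      fix a x assume *: "\<forall>x\<in>ob X. p * \<mu> x \<le> \<nu> (S x)" and a: "a \<in> ob A" and x: "x \<in> ob X"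
      have "hom A (S x) a * (p * \<mu> x) \<le> hom A (S x) a * \<nu> (S x)"
        using * x by (intro residuated_mult_left_mono) blast
      also have "\<dots> \<le> \<nu> a"
        using \<nu> a enriched_functor_ob[OF S x] by (simp add: copresheaf_iff mult.commute)
      finally show "p * (hom A (S x) a * \<mu> x) \<le> \<nu> a"
        by (simp add: ac_simps)
    qed
    moreover have "(p \<le> hom (copresheaves A) (left_kan X A S \<mu>) \<nu>) \<longleftrightarrow>
        (\<forall>a\<in>ob A. \<forall>x\<in>ob X. p * (hom A (S x) a * \<mu> x) \<le> \<nu> a)"
      using \<mu> by (simp add: left_kan_def le_INF_iff residuation[symmetric] mult.commute[of _ p]
          residuated_mult_SUP_le_iff)
    moreover have "(p \<le> hom (copresheaves X) \<mu> (precomposition X A S \<nu>)) \<longleftrightarrow>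
        (\<forall>x\<in>ob X. p * \<mu> x \<le> \<nu> (S x))"
      using \<nu> by (simp add: precomposition_apply le_INF_iff residuation[symmetric] mult.commute[of _ p])
    ultimately show ?thesis
      by simp
  qed
  then show "hom (copresheaves A) (left_kan X A S \<mu>) \<nu> =
      hom (copresheaves X) \<mu> (precomposition X A S \<nu>)"
    by (rule order_eq_if_same_lower_bounds)
qed

text \<open>Dual to the left case: the object \<open>a\<close> now sits at the source, so the action
  of \<open>\<nu>\<close> runs along \<open>hom A a (S x)\<close> into \<open>S x\<close>.\<close>

lemma right_kan_adjoint:
  assumes A: "enriched_category A" and S: "S \<in> enriched_functors X A"
  shows "left_adjoint (copresheaves A) (copresheaves X) (precomposition X A S) (right_kan X A S)"
proof (rule left_adjointI[OF enriched_category_copresheaves enriched_category_copresheaves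
      precomposition_PiE[OF S] right_kan_PiE[OF A S]])
  fix \<nu> \<mu> assume \<nu>: "\<nu> \<in> ob (copresheaves A)" and \<mu>: "\<mu> \<in> ob (copresheaves X)"
  have "(p \<le> hom (copresheaves X) (precomposition X A S \<nu>) \<mu>) \<longleftrightarrow>
      (p \<le> hom (copresheaves A) \<nu> (right_kan X A S \<mu>))" for p
  proof -
    have "(\<forall>x\<in>ob X. \<nu> (S x) * p \<le> \<mu> x) \<longleftrightarrow>
        (\<forall>a\<in>ob A. \<forall>x\<in>ob X. hom A a (S x) * (\<nu> a * p) \<le> \<mu> x)"
    proof (intro iffI ballI)
      fix x assume *: "\<forall>a\<in>ob A. \<forall>x\<in>ob X. hom A a (S x) * (\<nu> a * p) \<le> \<mu> x" and x: "x \<in> ob X"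
      have ob: "S x \<in> ob A"
        using S x by (rule enriched_functor_ob)
      have "1 * (\<nu> (S x) * p) \<le> hom A (S x) (S x) * (\<nu> (S x) * p)"
        using enriched_category_id[OF A ob] by (rule residuated_mult_mono) simp
      also have "\<dots> \<le> \<mu> x"
        using * x ob by blast
      finally show "\<nu> (S x) * p \<le> \<mu> x"
        by simp
    next
      fix a x assume *: "\<forall>x\<in>ob X. \<nu> (S x) * p \<le> \<mu> x" and a: "a \<in> ob A" and x: "x \<in> ob X"
      have "\<nu> a * hom A a (S x) \<le> \<nu> (S x)"
        using \<nu> a enriched_functor_ob[OF S x] by (simp add: copresheaf_iff)
      then have "\<nu> a * hom A a (S x) * p \<le> \<nu> (S x) * p"
        by (rule residuated_mult_mono) simp
      also have "\<dots> \<le> \<mu> x"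
        using * x by blast
      finally show "hom A a (S x) * (\<nu> a * p) \<le> \<mu> x"
        by (simp add: ac_simps)
    qed
    moreover have "(p \<le> hom (copresheaves X) (precomposition X A S \<nu>) \<mu>) \<longleftrightarrow>
        (\<forall>x\<in>ob X. \<nu> (S x) * p \<le> \<mu> x)"
      using \<nu> by (simp add: precomposition_apply le_INF_iff residuation)
    moreover have "(p \<le> hom (copresheaves A) \<nu> (right_kan X A S \<mu>)) \<longleftrightarrow>
        (\<forall>a\<in>ob A. \<forall>x\<in>ob X. hom A a (S x) * (\<nu> a * p) \<le> \<mu> x)"
      using \<mu> by (simp add: right_kan_def le_INF_iff residuation[symmetric])
    ultimately show ?thesis
      by simp
  qed
  then show "hom (copresheaves X) (precomposition X A S \<nu>) \<mu> =
      hom (copresheaves A) \<nu> (right_kan X A S \<mu>)"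
    by (rule order_eq_if_same_lower_bounds)
qed

section \<open>Closed forms of the approximations and their comparison under an update\<close>

lemma upper_approx_eq_left_kan:
  assumes "enriched_category A" "S \<in> enriched_functors X A"
  shows "upper_approx X A S = left_kan X A S"
  unfolding upper_approx_def
  \<comment> \<open>The Kan extension gives existence for the definite description; separation of
    copresheaf categories gives uniqueness.\<close>
  using left_kan_adjoint[OF assms]
    left_adjoint_unique[OF enriched_category_copresheaves copresheaves_separated]
  by (intro the_equality) blast+

lemma lower_approx_eq_right_kan:
  assumes "enriched_category A" "S \<in> enriched_functors X A"
  shows "lower_approx X A S = right_kan X A S"
  unfolding lower_approx_def
  using right_kan_adjoint[OF assms]
    right_adjoint_unique[OF enriched_category_copresheaves copresheaves_separated]
  by (intro the_equality) blast+

theorem theorem11: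
  fixes X :: "('x, 'l::complete_comm_residuated_lattice) enriched"
    and X' :: "('y, 'l) enriched"
    and A :: "('a, 'l) enriched"
  assumes "enriched_category X" and "enriched_category X'" and "enriched_category A"
    and "R \<in> enriched_functors X A" and "\<mu> \<in> enriched_functors X base_category"
    and "R' \<in> enriched_functors X' A" and "\<mu>' \<in> enriched_functors X' base_category"
    and "i \<in> enriched_functors X X'"
    and "compose (ob X) R' i = R" and "compose (ob X) \<mu>' i = \<mu>"
  shows "functor_le A base_category (upper_approx X A R \<mu>) (upper_approx X' A R' \<mu>') \<and>
         functor_le A base_category (lower_approx X' A R' \<mu>') (lower_approx X A R \<mu>)"
proof -
  have R: "R x = R' (i x)" and \<mu>: "\<mu> x = \<mu>' (i x)" and i: "i x \<in> ob X'" if "x \<in> ob X" for x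
    using that assms(9,10) enriched_functor_ob[OF assms(8)] by (auto simp: compose_def)
  have "(SUP x\<in>ob X. hom A (R x) a * \<mu> x) \<le> (SUP x\<in>ob X'. hom A (R' x) a * \<mu>' x)" for a
    \<comment> \<open>The term at \<open>x\<close> is matched by the equal term at
      \<open>i x\<close>; the same witness serves the infimum below.\<close>
    by (rule SUP_mono) (metis R \<mu> i order.refl)
  moreover have "(INF x\<in>ob X'. hom A a (R' x) \<rhd> \<mu>' x) \<le> (INF x\<in>ob X. hom A a (R x) \<rhd> \<mu> x)" for a
    by (rule INF_mono) (metis R \<mu> i order.refl)
  ultimately show ?thesis
    \<comment> \<open>With the closed forms inserted, \<open>one_le_residuum_iff\<close> reduces
      both claims to these pointwise inequalities.\<close>
    using assms(3-7)
    by (simp add: functor_le_def upper_approx_eq_left_kan lower_approx_eq_right_kan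
        left_kan_def right_kan_def one_le_residuum_iff)
qed

end
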